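(* Let $A$ be a finite alphabet of colors. The set of colored dual immaculate functions $\{\mathfrak{S}^*_I\}$, where $I$ ranges over all sentences over $A$, forms a basis of $QSym_A$.
   Context: Words over $A$ are finite sequences of colors; a sentence is a finite sequence $I=(w_1,\dots,w_k)$ of nonempty words (including the empty sentence $\emptyset$). Let $x_{a,i}$ ($a\in A$, $i\in\mathbb{Z}_{>0}$) be variables subject only to $x_{a,i}x_{b,j}=x_{b,j}x_{a,i}$ for $i\neq j$. For a word $w=c_1\cdots c_r$ put $x_{w,i}=x_{c_1,i}\cdots x_{c_r,i}$, $x_{\emptyset,i}=1$. For a sentence $I=(w_1,\dots,w_k)$ let $M_I=\sum_{1\le j_1<\dots<j_k}x_{w_1,j_1}\cdots x_{w_k,j_k}$ ($M_\emptyset=1$); $QSym_A$ is the $\mathbb{Q}$-span of all $M_I$ (these form a basis of it). For a sentence $J=(w_1,\dots,w_k)$ the colored composition diagram of shape $J$ has $k$ left-justified rows (row 1 on top), row $i$ having $|w_i|$ boxes colored in order by the letters of $w_i$. A colored immaculate tableau (CIT) of shape $J$ is a filling of its boxes by positive integers weakly increasing left to right in rows and strictly increasing top to bottom in the first column. Its type is the weak sentence $(u_1,\dots,u_m)$ where $u_i$ is the word of colors of boxes containing $i$, read from the lowest row to the highest row and left to right within rows; $x_T=x_{u_1,1}\cdots x_{u_m,m}$. The colored dual immaculate function is $\mathfrak{S}^*_J=\sum_T x_T$ over all CIT $T$ of shape $J$ ($\mathfrak{S}^*_\emptyset=1$). *)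

theory Defs
  imports Complex_Main "HOL-Library.Function_Algebras"
begin

(* Words are lists of colors; a sentence is a list of nonempty words. *)

definition sentences :: "'a set \<Rightarrow> 'a list list set" where
  "sentences A = lists (lists A - {[]})"

(* Since x_{a,i} and x_{b,j} commute exactly when i and j differ, the monomials form the
   restricted direct product over i of the free monoids on the letters x_{a,i}: a monomial is
   determined by the word it induces at each index i, almost all of these words being empty. *)

typedef 'a monomial = "{m :: nat \<Rightarrow> 'a list. finite {i. m i \<noteq> []}}"
  morphisms word_at Abs_monomial
  by (rule exI[of _ "\<lambda>_. []"]) simp

setup_lifting type_definition_monomial

instantiation monomial :: (type) monoid_mult
begin

lift_definition one_monomial :: "'a monomial" is "\<lambda>_. []" by simp

lift_definition times_monomial :: "'a monomial \<Rightarrow> 'a monomial \<Rightarrow> 'a monomial"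
  is "\<lambda>m n i. m i @ n i"
proof -
  fix m n :: "nat \<Rightarrow> 'a list"
  assume "finite {i. m i \<noteq> []}" "finite {i. n i \<noteq> []}"
  then show "finite {i. m i @ n i \<noteq> []}"
    by (rule finite_subset[rotated, OF finite_UnI]) auto
qed

instance
  by standard (transfer, simp)+

end

lift_definition var :: "'a \<Rightarrow> nat \<Rightarrow> 'a monomial" is "\<lambda>a i j. if j = i then [a] else []"
  by simp

lemma var_commute: "i \<noteq> j \<Longrightarrow> var a i * var b j = var b j * var a i"
  by transfer auto

definition x_word :: "'a list \<Rightarrow> nat \<Rightarrow> 'a monomial" where
  "x_word w i = prod_list (map (\<lambda>c. var c i) w)"

(* Formal power series over the rationals are coefficient functions; Function_Algebras supplies
   their pointwise addition. Its pointwise product is not the product of series and is not used. *)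

type_synonym 'a series = "'a monomial \<Rightarrow> rat"

definition scale_series :: "rat \<Rightarrow> 'a series \<Rightarrow> 'a series" where
  "scale_series c f = (\<lambda>m. c * f m)"

global_interpretation series: vector_space "scale_series :: rat \<Rightarrow> 'a series \<Rightarrow> 'a series"
  by standard (auto simp: scale_series_def fun_eq_iff algebra_simps)

(* The formal sum of the monomials X s over s in S. It makes sense when each monomial arises
   from finitely many s, as shown below for both families to which it is applied. *)

definition formal_sum :: "('s \<Rightarrow> 'a monomial) \<Rightarrow> 's set \<Rightarrow> 'a series" where
  "formal_sum X S = (\<lambda>m. of_nat (card {s \<in> S. X s = m}))"

definition increasing_indices :: "nat \<Rightarrow> nat list set" where
  "increasing_indices k = {js. length js = k \<and> (\<forall>j \<in> set js. 1 \<le> j) \<and> sorted_wrt (<) js}"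

definition monomial_qsym :: "'a list list \<Rightarrow> 'a series" where
  "monomial_qsym I =
     formal_sum (\<lambda>js. prod_list (map2 x_word I js)) (increasing_indices (length I))"

definition QSym :: "'a set \<Rightarrow> 'a series set" where
  "QSym A = series.span (monomial_qsym ` sentences A)"

(* A filling of the diagram of shape J is given by the list of its rows, top row first. *)

definition CIT :: "'a list list \<Rightarrow> nat list list set" where
  "CIT J = {T. map length T = map length J \<and>
               (\<forall>t \<in> set T. (\<forall>e \<in> set t. 1 \<le> e) \<and> sorted t) \<and>
               sorted_wrt (<) (map hd T)}"

definition row_word :: "nat \<Rightarrow> 'a list \<Rightarrow> nat list \<Rightarrow> 'a list" where
  "row_word i w t = map fst (filter (\<lambda>(c, e). e = i) (zip w t))"

(* The reversal makes the reading go from the lowest row to the highest. *)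

definition entry_word :: "'a list list \<Rightarrow> nat list list \<Rightarrow> nat \<Rightarrow> 'a list" where
  "entry_word J T i = concat (rev (map2 (row_word i) J T))"

(* The type is cut off at the largest entry; further terms would be empty words. *)

definition CIT_type :: "'a list list \<Rightarrow> nat list list \<Rightarrow> 'a list list" where
  "CIT_type J T = map (entry_word J T) [1..<Suc (Max (insert 0 (set (concat T))))]"

definition x_tableau :: "'a list list \<Rightarrow> nat list list \<Rightarrow> 'a monomial" where
  "x_tableau J T = (let us = CIT_type J T in prod_list (map2 x_word us [1..<Suc (length us)]))"

definition dual_immaculate :: "'a list list \<Rightarrow> 'a series" where
  "dual_immaculate J = formal_sum (x_tableau J) (CIT J)"

lemma word_at_one [simp]: "word_at 1 = (\<lambda>_. [])"
  by transfer simp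

lemma word_at_times [simp]: "word_at (m * n) i = word_at m i @ word_at n i"
  by transfer simp

lemma word_at_prod_list: "word_at (prod_list ms) i = concat (map (\<lambda>m. word_at m i) ms)"
  by (induction ms) auto

lemma word_at_var: "word_at (var c i) j = (if j = i then [c] else [])"
  by transfer simp

lemma word_at_x_word: "word_at (x_word w i) j = (if j = i then w else [])"
  by (induction w) (simp_all add: x_word_def word_at_var)

lemma finite_support: "finite {i. word_at m i \<noteq> []}"
  by transfer simp

lemma nth_pair_in_set_zip:
  assumes "k < length xs" "length xs = length ys"
  shows "(xs ! k, ys ! k) \<in> set (zip xs ys)"
  using assms nth_mem[of k "zip xs ys"] by simp

lemma finite_increasing_indices:
  assumes "I \<in> sentences A"
  shows "finite {js \<in> increasing_indices (length I). prod_list (map2 x_word I js) = m}"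
proof (rule finite_subset[OF _ finite_lists_length_eq[OF finite_support[of m], of "length I"]],
    clarsimp simp: increasing_indices_def)
  fix js j assume js: "length js = length I" "j \<in> set js"
    and z: "word_at (prod_list (map2 x_word I js)) j = []"
  obtain k where k: "k < length js" "js ! k = j" using js(2) unfolding in_set_conv_nth by blast
  have "k < length I" using k(1) unfolding js(1) .
  then have "(I ! k, j) \<in> set (zip I js)"
    using nth_pair_in_set_zip[of k I js, unfolded k(2)] js(1)[symmetric] by blast
  moreover have "I ! k \<noteq> []"
    using assms nth_mem[OF \<open>k < length I\<close>] unfolding sentences_def in_lists_conv_set by blast
  moreover have "word_at (x_word w k') j = []" if "(w, k') \<in> set (zip I js)" for w k'
    using z that unfolding word_at_prod_list concat_eq_Nil_conv by auto
  ultimately show False using word_at_x_word[of "I ! k" j j] by auto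
qed

lemma word_at_x_tableau:
  assumes "i \<ge> 1"
  shows "word_at (x_tableau J T) i =
    (if i \<le> Max (insert 0 (set (concat T))) then entry_word J T i else [])"
proof -
  have aux: "concat (map (\<lambda>k. if i = k then f k else []) [1..<Suc n]) =
      (if i \<le> n then f i else [])" for n and f :: "nat \<Rightarrow> 'a list"
    using assms by (induction n) auto
  have zip_map: "zip (map g xs) xs = map (\<lambda>k. (g k, k)) xs" for g :: "nat \<Rightarrow> 'a list" and xs
    by (induction xs) auto
  show ?thesis
    by (simp only: x_tableau_def Let_def CIT_type_def length_map length_upt diff_Suc_1
        word_at_prod_list zip_map map_map o_def case_prod_conv word_at_x_word aux)
qed

lemma row_word_nonempty:
  assumes "(c, e) \<in> set (zip w t)"
  shows "row_word e w t \<noteq> []"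
proof -
  have "(c, e) \<in> set (filter (\<lambda>(c, e'). e' = e) (zip w t))" using assms by simp
  then show ?thesis unfolding row_word_def by force
qed

lemma entry_word_nonempty:
  assumes "(w, t) \<in> set (zip J T)" "row_word e w t \<noteq> []"
  shows "entry_word J T e \<noteq> []"
proof -
  have "row_word e w t \<in> set (map2 (row_word e) J T)"
    using assms(1) by (simp add: image_iff) (metis case_prod_conv)
  then show ?thesis using assms(2) unfolding entry_word_def concat_eq_Nil_conv set_rev by blast
qed

lemma finite_CIT: "finite {T \<in> CIT J. x_tableau J T = m}"
proof -
  let ?S = "{i. word_at m i \<noteq> []}" and ?n = "Max (insert 0 (set (map length J)))"
  have "finite {T. set T \<subseteq> {t. set t \<subseteq> ?S \<and> length t \<le> ?n} \<and> length T = length J}"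
    by (intro finite_lists_length_eq finite_lists_length_le finite_support)
  moreover have "T \<in> {T. set T \<subseteq> {t. set t \<subseteq> ?S \<and> length t \<le> ?n} \<and> length T = length J}"
    if T: "T \<in> CIT J" "x_tableau J T = m" for T
  proof -
    have len: "map length T = map length J" using T by (simp add: CIT_def)
    have lenT: "length T = length J" using len by (metis length_map)
    { fix t assume t: "t \<in> set T"
      then have "length t \<in> set (map length J)" by (metis len image_eqI list.set_map)
      then have "length t \<le> ?n" by simp
      moreover have "word_at m e \<noteq> []" if e: "e \<in> set t" for e
      proof -
        obtain r where r: "r < length T" "T ! r = t" using t unfolding in_set_conv_nth by blast
        obtain c where c: "c < length t" "t ! c = e" using e unfolding in_set_conv_nth by blast
        have "length (J ! r) = length t"
          using arg_cong[OF len, of "\<lambda>l. l ! r"] r lenT by simp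
        with c(1) have "(J ! r ! c, t ! c) \<in> set (zip (J ! r) t)"
          by (intro nth_pair_in_set_zip) simp_all
        then have "(J ! r ! c, e) \<in> set (zip (J ! r) t)" unfolding c(2) .
        then have "row_word e (J ! r) t \<noteq> []" by (rule row_word_nonempty)
        moreover have "(J ! r, T ! r) \<in> set (zip J T)"
          using r(1) lenT by (intro nth_pair_in_set_zip) simp_all
        then have "(J ! r, t) \<in> set (zip J T)" unfolding r(2) .
        ultimately have "entry_word J T e \<noteq> []" by (rule entry_word_nonempty[rotated])
        moreover have "e \<le> Max (insert 0 (set (concat T)))"
          using t e by (intro Max_ge) auto
        moreover have "1 \<le> e" using T(1) t e unfolding CIT_def by blast
        ultimately show ?thesis using T(2) word_at_x_tableau[of e J T] by simp
      qed
      ultimately have "set t \<subseteq> ?S \<and> length t \<le> ?n" by blast }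
    then show ?thesis using lenT by blast
  qed
  then have "{T \<in> CIT J. x_tableau J T = m}
      \<subseteq> {T. set T \<subseteq> {t. set t \<subseteq> ?S \<and> length t \<le> ?n} \<and> length T = length J}"
    by blast
  ultimately show ?thesis by (rule rev_finite_subset)
qed

lemma monomial_qsym_Nil: "monomial_qsym [] m = (if m = 1 then 1 else 0)"
proof -
  have "increasing_indices 0 = {[]}" by (simp add: increasing_indices_def) auto
  then show ?thesis
    by (simp add: monomial_qsym_def formal_sum_def Collect_conv_if)
qed

lemma dual_immaculate_Nil: "dual_immaculate [] (m :: 'a monomial) = (if m = 1 then 1 else 0)"
proof -
  have cit: "CIT ([] :: 'a list list) = {[]}" by (simp add: CIT_def) auto
  have x: "x_tableau ([] :: 'a list list) [] = 1" by (simp add: x_tableau_def CIT_type_def)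
  show ?thesis
  proof (cases "m = 1")
    case True
    then have "{T \<in> CIT ([] :: 'a list list). x_tableau [] T = m} = {[]}"
      unfolding cit using x by blast
    then show ?thesis using True by (simp only: dual_immaculate_def formal_sum_def) simp
  next
    case False
    then have "{T \<in> CIT ([] :: 'a list list). x_tableau [] T = m} = {}"
      unfolding cit using x by blast
    then show ?thesis using False by (simp only: dual_immaculate_def formal_sum_def) simp
  qed
qed

end

theory Submission
  imports Defs
begin

text \<open>
  The coefficients of a dual immaculate function are unchanged when the indices of a monomial are
  relabelled monotonically, so each dual immaculate function is a combination of the monomial
  functions of the same size. The expansion is unitriangular with respect to the weight
  \<open>\<Sum>i. i * length w\<^sub>i\<close> of a sentence: the sum of the entries of a tableau is the weight
  of its type, and since the entries in row \<open>i\<close> are at least \<open>i\<close>, this sum is at least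
  the weight of the shape, with equality only for the tableau whose row \<open>i\<close> is constantly
  \<open>i\<close>, whose type is its shape.
\<close>

section \<open>Monomials determined by a sentence and an increasing list of indices\<close>

declare upt_Suc [simp del]

text \<open>The summand of \<open>monomial_qsym I\<close> at the index list
  \<open>js\<close>.\<close>

definition sentence_monomial :: "'a list list \<Rightarrow> nat list \<Rightarrow> 'a monomial" where
  "sentence_monomial I js = prod_list (map2 x_word I js)"

lemma monomial_eqI: "(\<And>i. word_at m i = word_at n i) \<Longrightarrow> m = n"
  by (metis ext word_at_inject)

lemma word_at_sentence_monomial:
  assumes "length I = length js" "distinct js"
  shows "word_at (sentence_monomial I js) i =
    (case map_of (zip js I) i of None \<Rightarrow> [] | Some w \<Rightarrow> w)"
proof -
  have "map_of (zip js I) i = None" if "i \<notin> set js" for js :: "nat list" and I :: "'a list list"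
    using that by (auto simp: map_of_eq_None_iff dest: set_zip_leftD)
  with assms show ?thesis
    by (induction I js rule: list_induct2)
      (auto simp: sentence_monomial_def word_at_x_word)
qed

lemma word_at_sentence_monomial_nth:
  assumes "length I = length js" "distinct js" "k < length js"
  shows "word_at (sentence_monomial I js) (js ! k) = I ! k"
  using assms by (simp add: word_at_sentence_monomial map_of_zip_nth)

lemma word_at_sentence_monomial_notin:
  assumes "length I = length js" "distinct js" "i \<notin> set js"
  shows "word_at (sentence_monomial I js) i = []"
proof -
  have "map_of (zip js I) i = None"
    using assms(3) by (auto simp: map_of_eq_None_iff dest: set_zip_leftD)
  then show ?thesis by (simp only: word_at_sentence_monomial[OF assms(1,2)] option.case)
qed

lemma support_sentence_monomial:
  assumes "length I = length js" "distinct js" "[] \<notin> set I"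
  shows "{i. word_at (sentence_monomial I js) i \<noteq> []} = set js"
proof (intro equalityI subsetI)
  fix i assume "i \<in> {i. word_at (sentence_monomial I js) i \<noteq> []}"
  then show "i \<in> set js" using word_at_sentence_monomial_notin[OF assms(1,2)] by blast
next
  fix i assume "i \<in> set js"
  then obtain k where "k < length js" "i = js ! k" by (metis in_set_conv_nth)
  then have "word_at (sentence_monomial I js) i \<in> set I"
    using word_at_sentence_monomial_nth[OF assms(1,2)] assms(1) by simp
  then show "i \<in> {i. word_at (sentence_monomial I js) i \<noteq> []}" using assms(3) by auto
qed

lemma increasing_indicesD:
  assumes "js \<in> increasing_indices k"
  shows "length js = k" "distinct js" "sorted js" "0 \<notin> set js" "sorted_wrt (<) js"
  using assms by (auto simp: increasing_indices_def strict_sorted_iff)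

lemma upt_increasing_indices: "[1..<Suc k] \<in> increasing_indices k"
  by (simp add: increasing_indices_def)

text \<open>As no word is empty, the support of the monomial is exactly \<open>set js\<close>; an
  increasing list is determined by its set, and the words found at these indices give back the
  sentence.\<close>

lemma sentence_monomial_inject:
  assumes "[] \<notin> set I" "js \<in> increasing_indices (length I)"
    and "[] \<notin> set I'" "js' \<in> increasing_indices (length I')"
    and eq: "sentence_monomial I js = sentence_monomial I' js'"
  shows "I = I' \<and> js = js'"
proof -
  note D = increasing_indicesD[OF assms(2)] and D' = increasing_indicesD[OF assms(4)]
  have "set js = set js'"
    using support_sentence_monomial[of I js] support_sentence_monomial[of I' js'] assms D D'
    by simp
  then have js: "js = js'" using D(2,3) D'(2,3) by (simp add: sorted_distinct_set_unique)
  moreover have "I = I'"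
  proof (rule nth_equalityI)
    show "length I = length I'" using js D(1) D'(1) by simp
  next
    fix k assume "k < length I"
    then show "I ! k = I' ! k"
      using word_at_sentence_monomial_nth[of I js k] word_at_sentence_monomial_nth[of I' js k]
        D D' eq js by simp
  qed
  ultimately show ?thesis by simp
qed

text \<open>Listing the support in increasing order gives the indices, and the words found there
  form the sentence. Index 0 has to be excluded because the type of monomials allows it while the
  variables of the theorem start at 1.\<close>

lemma monomial_as_sentence_monomial:
  assumes "word_at m 0 = []"
  obtains I js where "[] \<notin> set I" "js \<in> increasing_indices (length I)"
    "m = sentence_monomial I js"
proof
  let ?js = "sorted_list_of_set {i. word_at m i \<noteq> []}"
  let ?I = "map (word_at m) ?js"
  show "[] \<notin> set ?I" using finite_support[of m] by auto
  show "?js \<in> increasing_indices (length ?I)"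
    using finite_support[of m] assms
    by (auto simp: increasing_indices_def Suc_le_eq intro: gr0I)
  show "m = sentence_monomial ?I ?js"
  proof (rule monomial_eqI)
    fix i
    show "word_at m i = word_at (sentence_monomial ?I ?js) i"
    proof (cases "word_at m i = []")
      case True
      then show ?thesis using finite_support[of m]
        by (subst word_at_sentence_monomial_notin) auto
    next
      case False
      then have "i \<in> set ?js" using finite_support[of m] by simp
      then obtain k where k: "k < length ?js" "i = ?js ! k" by (metis in_set_conv_nth)
      then have "word_at (sentence_monomial ?I ?js) i = ?I ! k"
        using word_at_sentence_monomial_nth[of ?I ?js k] by simp
      then show ?thesis using k by simp
    qed
  qed
qed

lemma monomial_qsym_eq_card:
  "monomial_qsym I m = of_nat (card {js \<in> increasing_indices (length I). sentence_monomial I js = m})"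
  by (simp add: monomial_qsym_def formal_sum_def sentence_monomial_def)

text \<open>By injectivity at most one index list contributes. The coefficients of a combination of
  monomial functions can thus be read off at these monomials.\<close>

lemma monomial_qsym_sentence_monomial:
  assumes "[] \<notin> set I" "[] \<notin> set I'" "js' \<in> increasing_indices (length I')"
  shows "monomial_qsym I (sentence_monomial I' js') = (if I = I' then 1 else 0)"
proof -
  have "{js \<in> increasing_indices (length I). sentence_monomial I js = sentence_monomial I' js'}
      = (if I = I' then {js'} else {})"
    using sentence_monomial_inject[OF assms(1) _ assms(2,3)] assms(3) by auto
  then show ?thesis by (simp add: monomial_qsym_eq_card)
qed

lemma monomial_qsym_eq_0:
  assumes "word_at m 0 \<noteq> []"
  shows "monomial_qsym I m = 0"
proof -
  have "word_at (sentence_monomial I js) 0 = []" if "js \<in> increasing_indices (length I)" for js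
    using increasing_indicesD[OF that] by (simp add: word_at_sentence_monomial_notin)
  then have "{js \<in> increasing_indices (length I). sentence_monomial I js = m} = {}"
    using assms by blast
  then show ?thesis by (simp only: monomial_qsym_eq_card) simp
qed

section \<open>Reading words and entries of tableaux\<close>

lemma row_word_Cons [simp]:
  "row_word i (c # w) (e # t) = (if e = i then c # row_word i w t else row_word i w t)"
  by (simp add: row_word_def)

lemma row_word_Nil [simp]: "row_word i [] t = []"
  by (simp add: row_word_def)

lemma entry_word_Nil [simp]: "entry_word [] T i = []"
  by (simp add: entry_word_def)

lemma entry_word_Cons [simp]: "entry_word (w # J) (t # T) i = entry_word J T i @ row_word i w t"
  by (simp add: entry_word_def)

lemma length_row_word: "length t = length w \<Longrightarrow> length (row_word i w t) = count_list t i"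
  by (induction t w rule: list_induct2) auto

lemma length_entry_word:
  "map length T = map length J \<Longrightarrow> length (entry_word J T i) = count_list (concat T) i"
  by (induction T arbitrary: J) (auto simp: Cons_eq_map_conv length_row_word)

lemma entry_word_eq_Nil_iff:
  "map length T = map length J \<Longrightarrow> entry_word J T i = [] \<longleftrightarrow> i \<notin> set (concat T)"
  by (metis length_0_conv length_entry_word count_list_0_iff)

lemma set_row_word: "set (row_word i w t) \<subseteq> set w"
  by (auto simp: row_word_def dest: set_zip_leftD)

lemma set_entry_word: "set (entry_word J T i) \<subseteq> set (concat J)"
  using set_row_word by (fastforce simp: entry_word_def dest: set_zip_leftD)

text \<open>Injectivity includes \<open>i\<close> itself, so that no entry other than
  \<open>i\<close> is sent to \<open>f i\<close>.\<close>

lemma row_word_map: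
  "inj_on f (insert i (set t)) \<Longrightarrow> row_word (f i) w (map f t) = row_word i w t"
proof (induction t arbitrary: w)
  case (Cons e t)
  then have "inj_on f (insert i (set t))" "f e = f i \<longleftrightarrow> e = i"
    by (auto simp: inj_on_def)
  with Cons show ?case by (cases w) auto
qed (simp add: row_word_def)

lemma entry_word_map:
  "inj_on f (insert i (set (concat T))) \<Longrightarrow> entry_word J (map (map f) T) (f i) = entry_word J T i"
proof (induction T arbitrary: J)
  case (Cons t T)
  then have "inj_on f (insert i (set (concat T)))" "inj_on f (insert i (set t))"
    by (auto intro: inj_on_subset)
  with Cons.IH show ?case by (cases J) (auto simp: row_word_map)
qed (simp add: entry_word_def)

lemma CIT_lengths: "T \<in> CIT J \<Longrightarrow> map length T = map length J"
  by (simp add: CIT_def)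

lemma CIT_zero_notin: "T \<in> CIT J \<Longrightarrow> 0 \<notin> set (concat T)"
  by (fastforce simp: CIT_def)

lemma CIT_rows_nonempty:
  assumes "T \<in> CIT J" "[] \<notin> set J"
  shows "[] \<notin> set T"
proof
  assume "[] \<in> set T"
  then have "0 \<in> length ` set J"
    using CIT_lengths[OF assms(1)] by (metis image_eqI list.set_map list.size(3))
  then show False using assms(2) by auto
qed

text \<open>The cutoff in \<open>CIT_type\<close> is harmless: beyond the largest entry there is no
  box to read, and at index 0 the product has no factor and the tableau no entry.\<close>

lemma word_at_x_tableau_CIT:
  assumes "T \<in> CIT J"
  shows "word_at (x_tableau J T) i = entry_word J T i"
proof (cases "i = 0")
  case True
  have "word_at (x_tableau J T) 0 = []"
    by (auto simp: x_tableau_def Let_def word_at_prod_list word_at_x_word dest!: set_zip_rightD)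
  then show ?thesis
    using True entry_word_eq_Nil_iff[OF CIT_lengths[OF assms], of 0] CIT_zero_notin[OF assms]
    by metis
next
  case False
  have "entry_word J T i = []" if "i > Max (insert 0 (set (concat T)))"
    using that entry_word_eq_Nil_iff[OF CIT_lengths[OF assms], of i]
      Max_ge[of "insert 0 (set (concat T))" i] by fastforce
  moreover have "1 \<le> i" using False by simp
  ultimately show ?thesis by (metis word_at_x_tableau leI)
qed

lemma x_tableau_eq_iff:
  "T \<in> CIT J \<Longrightarrow> x_tableau J T = m \<longleftrightarrow> (\<forall>i. entry_word J T i = word_at m i)"
  by (metis monomial_eqI word_at_x_tableau_CIT)

lemma CIT_entries:
  assumes "T \<in> CIT J"
  shows "set (concat T) = {i. word_at (x_tableau J T) i \<noteq> []}"
  using word_at_x_tableau_CIT[OF assms] entry_word_eq_Nil_iff[OF CIT_lengths[OF assms]] by auto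

section \<open>Invariance of the coefficients under monotone relabelling of indices\<close>

lemma dual_immaculate_eq_card:
  "dual_immaculate J m = of_nat (card {T \<in> CIT J. x_tableau J T = m})"
  by (simp add: dual_immaculate_def formal_sum_def)

lemma dual_immaculate_eq_0:
  assumes "word_at m 0 \<noteq> []"
  shows "dual_immaculate J m = 0"
proof -
  have "{T \<in> CIT J. x_tableau J T = m} = {}"
    using assms CIT_entries CIT_zero_notin by blast
  then show ?thesis by (simp only: dual_immaculate_eq_card) simp
qed

text \<open>Rows stay sorted by monotonicity and the first column stays increasing by strictness;
  nonempty rows ensure that \<open>hd\<close> commutes with \<open>map f\<close>.\<close>

lemma CIT_map_strict_mono_on:
  assumes T: "T \<in> CIT J" and J: "[] \<notin> set J"
    and f: "strict_mono_on (set (concat T)) f" "0 \<notin> f ` set (concat T)"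
  shows "map (map f) T \<in> CIT J"
proof -
  have ne: "t \<noteq> []" if "t \<in> set T" for t using CIT_rows_nonempty[OF T J] that by blast
  have mono: "mono_on (set (concat T)) f" by (rule strict_mono_on_imp_mono_on[OF f(1)])
  have "sorted (map f t)" if t: "t \<in> set T" for t
  proof -
    have "sorted_wrt (\<le>) t" using T t by (simp add: CIT_def)
    then have "sorted_wrt (\<lambda>x y. f x \<le> f y) t"
      by (rule sorted_wrt_mono_rel[rotated]) (use mono t in \<open>auto simp: mono_on_def\<close>)
    then show ?thesis by (simp add: sorted_wrt_map)
  qed
  moreover have "1 \<le> f e" if "t \<in> set T" "e \<in> set t" for t e
    using f(2) that by (force simp: Suc_le_eq intro: gr0I)
  moreover have "sorted_wrt (<) (map hd (map (map f) T))"
  proof -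
    have "sorted_wrt (\<lambda>s t. hd s < hd t) T" using T by (simp add: CIT_def sorted_wrt_map)
    then have "sorted_wrt (\<lambda>s t. hd (map f s) < hd (map f t)) T"
    proof (rule sorted_wrt_mono_rel[rotated])
      fix s t assume st: "s \<in> set T" "t \<in> set T" "hd s < hd t"
      then have "hd s \<in> set (concat T)" "hd t \<in> set (concat T)" using ne hd_in_set by force+
      then show "hd (map f s) < hd (map f t)"
        using st ne strict_mono_onD[OF f(1)] by (simp add: hd_map)
    qed
    then show ?thesis by (simp add: sorted_wrt_map)
  qed
  ultimately show ?thesis using CIT_lengths[OF T] by (auto simp: CIT_def o_def)
qed

text \<open>Relabelling entries by the increasing bijection from \<open>js\<close> to
  \<open>js'\<close> embeds one set of tableaux into the other. An inequality suffices, since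
  exchanging \<open>js\<close> and \<open>js'\<close> gives the reverse one.\<close>

lemma card_CIT_relabel_le:
  assumes I: "[] \<notin> set I" and J: "[] \<notin> set J"
    and js: "js \<in> increasing_indices (length I)" and js': "js' \<in> increasing_indices (length I)"
  shows "card {T \<in> CIT J. x_tableau J T = sentence_monomial I js}
    \<le> card {T \<in> CIT J. x_tableau J T = sentence_monomial I js'}"
proof -
  note D = increasing_indicesD[OF js] and D' = increasing_indicesD[OF js']
  \<comment> \<open>\<open>f\<close> sends the \<open>k\<close>-th index of \<open>js\<close> to the
    \<open>k\<close>-th index of \<open>js'\<close>. Off \<open>set js\<close> its value is
    unspecified, so the facts about \<open>f\<close> are relative to \<open>set js\<close>.\<close>
  define f where "f = the \<circ> map_of (zip js js')"
  have f: "f (js ! k) = js' ! k" if "k < length js" for k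
    using that D D' by (simp add: f_def map_of_zip_nth)
  have mono: "strict_mono_on (set js) f"
  proof (rule strict_mono_onI)
    fix x y assume "x \<in> set js" "y \<in> set js" "x < y"
    then obtain k l where kl: "k < length js" "l < length js" "x = js ! k" "y = js ! l"
      by (metis in_set_conv_nth)
    then have "k < l" using \<open>x < y\<close> D(3) sorted_nth_mono by (metis linorder_not_less)
    then have "js' ! k < js' ! l" using kl D(1) D'(1,5) by (simp add: sorted_wrt_nth_less)
    then show "f x < f y" using kl f by simp
  qed
  then have inj: "inj_on f (set js)" by (rule strict_mono_on_imp_inj_on)
  have f_image: "f ` set js = set js'"
    using f D(1) D'(1) by (force simp: in_set_conv_nth image_iff)
  \<comment> \<open>As all words of \<open>I\<close> are nonempty, each index in \<open>js\<close>
    really occurs in \<open>T\<close>.\<close>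
  have entries: "set (concat T) = set js"
    if "T \<in> CIT J" "x_tableau J T = sentence_monomial I js" for T
    using CIT_entries[OF that(1)] that(2) support_sentence_monomial[of I js] D(1,2) I by simp
  show ?thesis
  proof (rule card_inj_on_le[of "map (map f)"])
    show "finite {T \<in> CIT J. x_tableau J T = sentence_monomial I js'}" by (rule finite_CIT)
    show "inj_on (map (map f)) {T \<in> CIT J. x_tableau J T = sentence_monomial I js}"
    proof (rule inj_on_inverseI)
      fix T assume "T \<in> {T \<in> CIT J. x_tableau J T = sentence_monomial I js}"
      then have "e \<in> set js" if "t \<in> set T" "e \<in> set t" for t e
        using entries[of T] that by auto
      then show "map (map (inv_into (set js) f)) (map (map f) T) = T"
        using inv_into_f_f[OF inj] by (auto intro!: map_idI)
    qed
    show "map (map f) ` {T \<in> CIT J. x_tableau J T = sentence_monomial I js}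
        \<subseteq> {T \<in> CIT J. x_tableau J T = sentence_monomial I js'}"
    proof clarify
      fix T assume T: "T \<in> CIT J" "x_tableau J T = sentence_monomial I js"
      note E = entries[OF T]
      have CIT: "map (map f) T \<in> CIT J"
        using CIT_map_strict_mono_on[OF T(1) J] E mono f_image D'(4) by simp
      moreover have "entry_word J (map (map f) T) i = word_at (sentence_monomial I js') i" for i
      proof (cases "i \<in> set js'")
        case True
        then obtain k where k: "k < length js" "i = js' ! k"
          using D(1) D'(1) by (metis in_set_conv_nth)
        have "entry_word J (map (map f) T) (f (js ! k)) = entry_word J T (js ! k)"
          using inj E k by (intro entry_word_map) (simp add: insert_absorb)
        also have "\<dots> = I ! k"
          using T k D(1,2) by (simp add: x_tableau_eq_iff word_at_sentence_monomial_nth)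
        finally show ?thesis
          using k f D(1) D'(1,2) by (simp add: word_at_sentence_monomial_nth)
      next
        case False
        \<comment> \<open>Since \<open>f\<close> maps \<open>set js\<close> onto
          \<open>set js'\<close>, an index outside \<open>set js'\<close> is not an entry of the
          relabelled tableau.\<close>
        moreover have "set (concat (map (map f) T)) = f ` set (concat T)" by auto
        ultimately have "entry_word J (map (map f) T) i = []"
          using entry_word_eq_Nil_iff[OF CIT_lengths[OF CIT]] f_image E by simp
        then show ?thesis using False D'(1,2) by (simp add: word_at_sentence_monomial_notin)
      qed
      ultimately show "map (map f) T \<in> CIT J \<and> x_tableau J (map (map f) T) = sentence_monomial I js'"
        by (simp add: x_tableau_eq_iff)
    qed
  qed
qed

abbreviation standard_monomial :: "'a list list \<Rightarrow> 'a monomial" where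
  "standard_monomial I \<equiv> sentence_monomial I [1..<Suc (length I)]"

lemma dual_immaculate_quasisymmetric:
  assumes "[] \<notin> set I" "[] \<notin> set J" "js \<in> increasing_indices (length I)"
  shows "dual_immaculate J (sentence_monomial I js) = dual_immaculate J (standard_monomial I)"
  unfolding dual_immaculate_eq_card
  using card_CIT_relabel_le[OF assms(1,2,3) upt_increasing_indices]
    card_CIT_relabel_le[OF assms(1,2) upt_increasing_indices assms(3)] by simp

section \<open>Weights and unitriangularity of the coefficients\<close>

text \<open>Taken with \<open>g = id\<close> for the weight that orders sentences, and with the
  constant 1 for the number of letters.\<close>

definition weighted_degree :: "(nat \<Rightarrow> nat) \<Rightarrow> 'a monomial \<Rightarrow> nat" where
  "weighted_degree g m = (\<Sum>i | word_at m i \<noteq> []. length (word_at m i) * g i)"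

text \<open>The word of \<open>x_tableau J T\<close> at \<open>i\<close> has one letter for each box
  filled with \<open>i\<close>, so summing over letters amounts to summing over boxes.\<close>

lemma weighted_degree_x_tableau:
  assumes "T \<in> CIT J"
  shows "weighted_degree g (x_tableau J T) = sum_list (map g (concat T))"
  unfolding weighted_degree_def CIT_entries[OF assms, symmetric]
  using word_at_x_tableau_CIT[OF assms] length_entry_word[OF CIT_lengths[OF assms]]
  by (simp add: sum_list_map_eq_sum_count)

definition standard_tableau :: "'a list list \<Rightarrow> nat list list" where
  "standard_tableau J = map2 (\<lambda>w i. replicate (length w) i) J [1..<Suc (length J)]"

lemma length_standard_tableau [simp]: "length (standard_tableau J) = length J"
  by (simp add: standard_tableau_def)

lemma nth_standard_tableau [simp]:
  "i < length J \<Longrightarrow> standard_tableau J ! i = replicate (length (J ! i)) (Suc i)"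
  by (simp add: standard_tableau_def)

lemma standard_tableau_CIT:
  assumes "[] \<notin> set J"
  shows "standard_tableau J \<in> CIT J"
proof -
  have ne: "length (J ! i) \<noteq> 0" if "i < length J" for i using assms that by (metis length_0_conv nth_mem)
  have "map length (standard_tableau J) = map length J" by (rule nth_equalityI) auto
  moreover have "(\<forall>e \<in> set t. 1 \<le> e) \<and> sorted t" if t: "t \<in> set (standard_tableau J)" for t
    using t by (auto simp: in_set_conv_nth[of t])
  moreover have "sorted_wrt (<) (map hd (standard_tableau J))"
    using ne by (auto simp: sorted_wrt_iff_nth_less)
  ultimately show ?thesis by (auto simp: CIT_def)
qed

lemma row_word_replicate: "row_word i w (replicate (length w) j) = (if i = j then w else [])"
  by (induction w) auto

text \<open>Distinctness of \<open>js\<close> puts each entry in a single row, so the bottom-to-top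
  reading order has no effect.\<close>

lemma entry_word_replicate:
  assumes "length J = length js" "distinct js"
  shows "entry_word J (map2 (\<lambda>w i. replicate (length w) i) J js) i =
    word_at (sentence_monomial J js) i"
  using assms
proof (induction J js rule: list_induct2)
  case (Cons w J j js)
  then show ?case
    using word_at_sentence_monomial_notin[of J js i]
    by (auto simp: row_word_replicate sentence_monomial_def word_at_x_word)
qed (simp add: sentence_monomial_def)

lemma x_tableau_standard_tableau:
  assumes "[] \<notin> set J"
  shows "x_tableau J (standard_tableau J) = standard_monomial J"
  using x_tableau_eq_iff[OF standard_tableau_CIT[OF assms]]
    entry_word_replicate[of J "[1..<Suc (length J)]"]
  by (simp add: standard_tableau_def)

lemma sum_list_le_eqD:
  fixes xs ys :: "nat list"
  assumes "list_all2 (\<le>) xs ys"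
  shows "sum_list xs \<le> sum_list ys \<and> (sum_list xs = sum_list ys \<longrightarrow> xs = ys)"
  using assms by induction auto

lemma strictly_sorted_ge_index:
  fixes xs :: "nat list"
  assumes "sorted_wrt (<) xs" "0 \<notin> set xs" "i < length xs"
  shows "Suc i \<le> xs ! i"
  using assms(3)
proof (induction i)
  case 0
  then show ?case using assms(2) by (metis Suc_leI gr0I nth_mem)
next
  case (Suc i)
  then have "xs ! i < xs ! Suc i" using assms(1) by (simp add: sorted_wrt_nth_less)
  with Suc show ?case by simp
qed

text \<open>The first column is positive and strictly increasing, which bounds the head of each row
  from below; weakly increasing rows pass the bound on to all boxes.\<close>

lemma standard_tableau_le:
  assumes T: "T \<in> CIT J" and J: "[] \<notin> set J"
  shows "list_all2 (\<le>) (concat (standard_tableau J)) (concat T)"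
proof -
  have len: "length T = length J" using CIT_lengths[OF T] by (metis length_map)
  have len': "length (T ! i) = length (J ! i)" if "i < length J" for i
    using CIT_lengths[OF T] that len by (metis nth_map)
  have ne: "t \<noteq> []" if "t \<in> set T" for t using CIT_rows_nonempty[OF T J] that by blast
  have "list_all2 (list_all2 (\<le>)) (standard_tableau J) T"
    unfolding list_all2_conv_all_nth
  proof (intro conjI allI impI)
    fix i j assume i: "i < length (standard_tableau J)" and j: "j < length (standard_tableau J ! i)"
    then have i': "i < length T" and j': "j < length (T ! i)" using len len' by simp_all
    have row: "sorted (T ! i)" using T nth_mem[OF i'] by (auto simp: CIT_def)
    have "0 \<notin> set (map hd T)"
      using CIT_zero_notin[OF T] ne by (force dest: hd_in_set)
    \<comment> \<open>Lists count rows from 0, so the row at position \<open>i\<close> has the bound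
      \<open>Suc i\<close>.\<close>
    then have "Suc i \<le> map hd T ! i"
      using T i' by (intro strictly_sorted_ge_index) (auto simp: CIT_def)
    also have "\<dots> = T ! i ! 0" using i' ne[OF nth_mem[OF i']] by (simp add: hd_conv_nth)
    also have "\<dots> \<le> T ! i ! j" using row j' by (simp add: sorted_nth_mono)
    finally show "standard_tableau J ! i ! j \<le> T ! i ! j" using i j by simp
  qed (use len len' in simp_all)
  then show ?thesis by (induction) (auto intro: list_all2_appendI)
qed

lemma concat_eq_lengths_eqD:
  "concat xs = concat ys \<Longrightarrow> map length xs = map length ys \<Longrightarrow> xs = ys"
  by (induction xs arbitrary: ys) (auto simp: Cons_eq_map_conv)

abbreviation weight :: "'a list list \<Rightarrow> nat" where
  "weight I \<equiv> weighted_degree id (standard_monomial I)"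

text \<open>Both weights are sums of entries, and \<open>T\<close> dominates the standard tableau
  box by box. Equal sums force equal entries, and the common shape recovers the rows.\<close>

lemma CIT_standard_monomial_cases:
  assumes T: "T \<in> CIT J" "x_tableau J T = standard_monomial I" and J: "[] \<notin> set J"
  shows "T = standard_tableau J \<or> weight J < weight I"
proof -
  have "weight I = sum_list (concat T)"
    using weighted_degree_x_tableau[OF T(1), of id] T(2) by simp
  moreover have "weight J = sum_list (concat (standard_tableau J))"
    using weighted_degree_x_tableau[OF standard_tableau_CIT[OF J], of id]
      x_tableau_standard_tableau[OF J] by simp
  moreover have "T = standard_tableau J" if "concat (standard_tableau J) = concat T"
    using that CIT_lengths[OF T(1)] CIT_lengths[OF standard_tableau_CIT[OF J]]
    by (intro concat_eq_lengths_eqD) simp_all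
  ultimately show ?thesis using sum_list_le_eqD[OF standard_tableau_le[OF T(1) J]] by linarith
qed

lemma dual_immaculate_standard_monomial_self:
  assumes "[] \<notin> set J"
  shows "dual_immaculate J (standard_monomial J) = 1"
proof -
  have "{T \<in> CIT J. x_tableau J T = standard_monomial J} = {standard_tableau J}"
    using CIT_standard_monomial_cases[of _ J J] standard_tableau_CIT
      x_tableau_standard_tableau assms by blast
  then show ?thesis by (simp only: dual_immaculate_eq_card) simp
qed

lemma dual_immaculate_standard_monomial_nonzero:
  assumes "[] \<notin> set I" "[] \<notin> set J" "dual_immaculate J (standard_monomial I) \<noteq> 0"
  shows "I = J \<or> weight J < weight I"
proof -
  obtain T where T: "T \<in> CIT J" "x_tableau J T = standard_monomial I"
    using assms(3) by (force simp: dual_immaculate_eq_card card_eq_0_iff)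
  show ?thesis
  proof (cases "weight J < weight I")
    case False
    then have "standard_monomial I = standard_monomial J"
      using CIT_standard_monomial_cases[OF T assms(2)] T(2) x_tableau_standard_tableau[OF assms(2)]
      by simp
    then show ?thesis
      using sentence_monomial_inject[OF assms(1) upt_increasing_indices assms(2) upt_increasing_indices]
      by simp
  qed simp
qed

section \<open>Expansion in monomial functions, one size at a time\<close>

text \<open>Fixing the number of letters leaves finitely many sentences over a finite alphabet, so
  that expansions become finite sums.\<close>

definition sentences_of_size :: "'a set \<Rightarrow> nat \<Rightarrow> 'a list list set" where
  "sentences_of_size A n = {I \<in> sentences A. length (concat I) = n}"

lemma sentencesD: "I \<in> sentences A \<Longrightarrow> [] \<notin> set I"
  by (auto simp: sentences_def)

lemma weighted_degree_one_standard_monomial: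
  assumes "[] \<notin> set I"
  shows "weighted_degree (\<lambda>_. 1) (standard_monomial I) = length (concat I)"
proof -
  have "map length (standard_tableau I) = map length I"
    by (rule CIT_lengths[OF standard_tableau_CIT[OF assms]])
  then have "length (concat (standard_tableau I)) = length (concat I)"
    by (simp add: length_concat)
  then show ?thesis
    using weighted_degree_x_tableau[OF standard_tableau_CIT[OF assms], of "\<lambda>_. 1"]
      x_tableau_standard_tableau[OF assms] by (simp add: sum_list_triv)
qed

lemma finite_sentences_of_size:
  assumes "finite A"
  shows "finite (sentences_of_size A n)"
proof (rule finite_subset)
  show "finite {I. set I \<subseteq> {w. set w \<subseteq> A \<and> length w \<le> n} \<and> length I \<le> n}"
    using assms by (intro finite_lists_length_le)
  show "sentences_of_size A n \<subseteq> {I. set I \<subseteq> {w. set w \<subseteq> A \<and> length w \<le> n} \<and> length I \<le> n}"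
  proof
    fix I assume "I \<in> sentences_of_size A n"
    then have I: "I \<in> sentences A" "length (concat I) = n"
      by (auto simp: sentences_of_size_def)
    have "length w \<le> length (concat I)" if "w \<in> set I" for w
      using that by (auto simp: length_concat intro: member_le_sum_list)
    moreover have "length I \<le> length (concat I)" using sentencesD[OF I(1)]
      by (induction I) (auto simp: Suc_le_eq intro: add_le_mono[of 1, simplified])
    ultimately show "I \<in> {I. set I \<subseteq> {w. set w \<subseteq> A \<and> length w \<le> n} \<and> length I \<le> n}"
      using I by (auto simp: sentences_def)
  qed
qed

text \<open>Both shape and type have one letter per box, and every letter of the type is the color
  of a box of \<open>J\<close>.\<close>

lemma CIT_type_in_sentences_of_size:
  assumes T: "T \<in> CIT J" "x_tableau J T = standard_monomial I"
    and J: "J \<in> sentences_of_size A n" and I: "[] \<notin> set I"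
  shows "I \<in> sentences_of_size A n"
proof -
  have J': "J \<in> sentences A" using J by (simp add: sentences_of_size_def)
  have "length (concat T) = length (concat J)"
    using CIT_lengths[OF T(1)] by (simp add: length_concat)
  then have "length (concat I) = n"
    using weighted_degree_x_tableau[OF T(1), of "\<lambda>_. 1"] T(2) J
      weighted_degree_one_standard_monomial[OF I]
    by (simp add: sum_list_triv sentences_of_size_def)
  moreover have "set w \<subseteq> A" if w: "w \<in> set I" for w
  proof -
    obtain k where k: "k < length I" "I ! k = w" using w by (metis in_set_conv_nth)
    then have "entry_word J T ([1..<Suc (length I)] ! k) = w"
      using T word_at_sentence_monomial_nth[of I "[1..<Suc (length I)]" k]
      by (simp add: x_tableau_eq_iff)
    then have "set w \<subseteq> set (concat J)" using set_entry_word by metis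
    then show ?thesis using J' by (auto simp: sentences_def)
  qed
  ultimately show ?thesis using I by (auto simp: sentences_of_size_def sentences_def)
qed

lemma sum_scale_series_apply:
  "(\<Sum>I\<in>S. scale_series (c I) (f I)) m = (\<Sum>I\<in>S. c I * f I m)"
  by (induction S rule: infinite_finite_induct) (simp_all add: scale_series_def)

text \<open>Coefficients are compared at every monomial. One without letters at index 0 is some
  \<open>sentence_monomial I js\<close>; there only the term of \<open>I\<close> survives, and
  relabelling replaces \<open>js\<close> by the standard indices.\<close>

lemma dual_immaculate_monomial_expansion:
  assumes "finite A" and J: "J \<in> sentences_of_size A n"
  shows "dual_immaculate J = (\<Sum>I\<in>sentences_of_size A n.
    scale_series (dual_immaculate J (standard_monomial I)) (monomial_qsym I))"
proof
  fix m :: "'a monomial"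
  let ?S = "sentences_of_size A n"
  have ne: "[] \<notin> set I" if "I \<in> ?S" for I
    using that sentencesD by (auto simp: sentences_of_size_def)
  show "dual_immaculate J m =
    (\<Sum>I\<in>?S. scale_series (dual_immaculate J (standard_monomial I)) (monomial_qsym I)) m"
  proof (cases "word_at m 0 = []")
    case False
    then show ?thesis
      by (simp add: sum_scale_series_apply monomial_qsym_eq_0 dual_immaculate_eq_0)
  next
    case True
    then obtain I js where I: "[] \<notin> set I" "js \<in> increasing_indices (length I)"
      and m: "m = sentence_monomial I js" by (rule monomial_as_sentence_monomial)
    have "(\<Sum>I'\<in>?S. dual_immaculate J (standard_monomial I') * monomial_qsym I' m)
        = (\<Sum>I'\<in>?S. if I' = I then dual_immaculate J (standard_monomial I) else 0)"
      using ne I by (intro sum.cong) (simp_all add: m monomial_qsym_sentence_monomial)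
    also have "\<dots> = (if I \<in> ?S then dual_immaculate J (standard_monomial I) else 0)"
      using finite_sentences_of_size[OF assms(1)] by simp
    also have "\<dots> = dual_immaculate J (standard_monomial I)"
    proof -
      \<comment> \<open>If \<open>I\<close> is not an index of the sum, the coefficient must vanish:
        no tableau of shape \<open>J\<close> has type \<open>I\<close>.\<close>
      have "{T \<in> CIT J. x_tableau J T = standard_monomial I} = {}" if "I \<notin> ?S"
        using that CIT_type_in_sentences_of_size[OF _ _ J I(1)] by blast
      then have "dual_immaculate J (standard_monomial I) = 0" if "I \<notin> ?S"
        using that unfolding dual_immaculate_eq_card by (metis card.empty of_nat_0)
      then show ?thesis by simp
    qed
    also have "\<dots> = dual_immaculate J m"
      using dual_immaculate_quasisymmetric[OF I(1) ne[OF J] I(2)] m by simp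
    finally show ?thesis by (simp add: sum_scale_series_apply)
  qed
qed

section \<open>Linear algebra of unitriangular families\<close>

text \<open>Solving the expansion of \<open>d J\<close> for \<open>b J\<close> leaves only vectors
  \<open>b I\<close> of larger weight, which are already known to lie in the span.\<close>

lemma (in vector_space) span_unitriangular:
  fixes w :: "'i \<Rightarrow> nat"
  assumes "finite S"
    and d: "\<And>J. J \<in> S \<Longrightarrow> d J = (\<Sum>I\<in>S. scale (k J I) (b I))"
    and diag: "\<And>J. J \<in> S \<Longrightarrow> k J J = 1"
    and upper: "\<And>I J. I \<in> S \<Longrightarrow> J \<in> S \<Longrightarrow> k J I \<noteq> 0 \<Longrightarrow> I = J \<or> w J < w I"
  shows "span (d ` S) = span (b ` S)"
  unfolding span_eq
proof
  show "d ` S \<subseteq> span (b ` S)"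
    using d by (auto intro!: span_sum span_scale intro: span_base)
  have "b J \<in> span (d ` S)" if "J \<in> S" for J
    using that
  \<comment> \<open>The measure is the distance of \<open>w J\<close> from the largest weight on
    \<open>S\<close>, so the induction descends from the heaviest indices.\<close>
  proof (induction "Max (w ` S) - w J" arbitrary: J rule: less_induct)
    case less
    have "b J = d J - (\<Sum>I\<in>S - {J}. scale (k J I) (b I))"
      using d[OF less.prems] diag[OF less.prems]
        sum.remove[OF \<open>finite S\<close> less.prems, of "\<lambda>I. scale (k J I) (b I)"] by simp
    moreover have "scale (k J I) (b I) \<in> span (d ` S)" if I: "I \<in> S - {J}" for I
    proof (cases "k J I = 0")
      case False
      then have "w J < w I" using upper I less.prems by blast
      moreover have "w I \<le> Max (w ` S)" using I \<open>finite S\<close> by simp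
      ultimately have "b I \<in> span (d ` S)" using less.hyps[of I] I by simp
      then show ?thesis by (rule span_scale)
    qed (simp add: span_zero)
    moreover have "d J \<in> span (d ` S)" using less.prems by (simp add: span_base)
    ultimately show "b J \<in> span (d ` S)" by (simp only: span_diff span_sum)
  qed
  then show "b ` S \<subseteq> span (d ` S)" by blast
qed

text \<open>The monomials \<open>\<mu> I\<close> serve as test points. In a vanishing combination,
  take \<open>I\<close> of least weight among the nonzero coefficients; at \<open>\<mu> I\<close>
  only the term of \<open>d I\<close> survives.\<close>

lemma independent_series_unitriangular:
  fixes d :: "'i \<Rightarrow> 'a series" and w :: "'i \<Rightarrow> nat"
  assumes diag: "\<And>J. J \<in> S \<Longrightarrow> d J (\<mu> J) \<noteq> 0"
    and upper: "\<And>I J. I \<in> S \<Longrightarrow> J \<in> S \<Longrightarrow> d J (\<mu> I) \<noteq> 0 \<Longrightarrow> I = J \<or> w J < w I"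
  shows "inj_on d S \<and> series.independent (d ` S)"
proof
  \<comment> \<open>If \<open>d I = d J\<close> with \<open>I\<close> and \<open>J\<close>
    different, testing at \<open>\<mu> I\<close> and at \<open>\<mu> J\<close> gives both
    \<open>w J < w I\<close> and \<open>w I < w J\<close>.\<close>
  show inj: "inj_on d S"
    using diag upper by (intro inj_onI) (metis less_asym)
  show "series.independent (d ` S)"
    unfolding series.independent_explicit_finite_subsets
  proof (intro allI impI ballI, rule ccontr)
    fix B u v assume B: "B \<subseteq> d ` S" "finite B" and sum: "(\<Sum>v\<in>B. scale_series (u v) v) = 0"
      and "v \<in> B" "u v \<noteq> 0"
    obtain F where F: "F \<subseteq> S" "B = d ` F" "finite F"
      using finite_subset_image[OF B(2,1)] by blast
    obtain J where "J \<in> F \<and> u (d J) \<noteq> 0" using \<open>v \<in> B\<close> \<open>u v \<noteq> 0\<close> F by blast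
    then obtain I where I: "I \<in> F" "u (d I) \<noteq> 0"
      and min: "\<And>J. J \<in> F \<Longrightarrow> u (d J) \<noteq> 0 \<Longrightarrow> w I \<le> w J"
      using ex_has_least_nat[of "\<lambda>J. J \<in> F \<and> u (d J) \<noteq> 0" _ w] by metis
    have "0 = (\<Sum>v\<in>B. u v * v (\<mu> I))"
      using fun_cong[OF sum, of "\<mu> I"] by (simp add: sum_scale_series_apply)
    also have "\<dots> = (\<Sum>J\<in>F. u (d J) * d J (\<mu> I))"
      unfolding F(2) by (rule sum.reindex_cong[OF inj_on_subset[OF inj F(1)]]) simp_all
    also have "\<dots> = (\<Sum>J\<in>F. if J = I then u (d I) * d I (\<mu> I) else 0)"
    proof (rule sum.cong)
      fix J assume J: "J \<in> F"
      have "u (d J) = 0 \<or> d J (\<mu> I) = 0" if "J \<noteq> I"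
        using upper[of I J] min[OF J] I(1) J F(1) that by force
      then show "u (d J) * d J (\<mu> I) = (if J = I then u (d I) * d I (\<mu> I) else 0)" by auto
    qed simp
    also have "\<dots> = u (d I) * d I (\<mu> I)" using F(3) I(1) by simp
    finally show False using I diag F(1) by auto
  qed
qed

theorem theorem4p21:
  fixes A :: "'a set"
  assumes "finite A"
  shows "inj_on dual_immaculate (sentences A) \<and>
         series.independent (dual_immaculate ` sentences A) \<and>
         series.span (dual_immaculate ` sentences A) = QSym A"
proof -
  let ?S = "sentences_of_size A"
  have sentences: "sentences A = (\<Union>n. ?S n)" by (auto simp: sentences_of_size_def)
  have ne: "[] \<notin> set I" if "I \<in> sentences A" for I using that by (rule sentencesD)
  \<comment> \<open>Each size provides the finite index set and the finite expansion that
    \<open>span_unitriangular\<close> requires, with \<open>weight\<close> as the order.\<close>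
  have "series.span (dual_immaculate ` ?S n) = series.span (monomial_qsym ` ?S n)" for n
    using finite_sentences_of_size[OF assms] dual_immaculate_monomial_expansion[OF assms]
  proof (rule series.span_unitriangular)
    show "dual_immaculate J (standard_monomial J) = 1" if "J \<in> ?S n" for J
      using that ne sentences by (blast intro: dual_immaculate_standard_monomial_self)
    show "I = J \<or> weight J < weight I"
      if "I \<in> ?S n" "J \<in> ?S n" "dual_immaculate J (standard_monomial I) \<noteq> 0" for I J
      using that(1,2) ne sentences
      by (intro dual_immaculate_standard_monomial_nonzero[OF _ _ that(3)]) blast+
  qed
  \<comment> \<open>Kept general in \<open>f\<close> and \<open>g\<close> because equality of the
    full spans uses it in both directions.\<close>
  moreover have "f ` sentences A \<subseteq> series.span (g ` sentences A)"
    if "\<And>n. series.span (f ` ?S n) = series.span (g ` ?S n)" for f g :: "'a list list \<Rightarrow> 'a series"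
  proof
    fix v assume "v \<in> f ` sentences A"
    then obtain n where "v \<in> f ` ?S n" using sentences by blast
    then have "v \<in> series.span (g ` ?S n)" using that series.span_base by blast
    moreover have "series.span (g ` ?S n) \<subseteq> series.span (g ` sentences A)"
      unfolding sentences by (intro series.span_mono) blast
    ultimately show "v \<in> series.span (g ` sentences A)" by blast
  qed
  ultimately have "series.span (dual_immaculate ` sentences A) = QSym A"
    unfolding QSym_def series.span_eq by simp
  moreover have "inj_on dual_immaculate (sentences A) \<and>
      series.independent (dual_immaculate ` sentences A)"
  \<comment> \<open>All sizes are treated at once, with the standard monomials as test
    points.\<close>
  proof (rule independent_series_unitriangular)
    show "dual_immaculate J (standard_monomial J) \<noteq> 0" if "J \<in> sentences A" for J
      using dual_immaculate_standard_monomial_self[OF ne[OF that]] by simp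
    show "I = J \<or> weight J < weight I" if "I \<in> sentences A" "J \<in> sentences A"
      "dual_immaculate J (standard_monomial I) \<noteq> 0" for I J
      using that by (intro dual_immaculate_standard_monomial_nonzero ne)
  qed
  ultimately show ?thesis by blast
qed

end
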